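(* Let $X$ be a real Hilbert space, let $A\colon X\rightrightarrows X$ be maximally monotone, let $T\colon X\to X$ be firmly nonexpansive, and suppose that $T=J_A$, or equivalently that $A=T^{-1}-\mathrm{Id}$. Then $A$ is paramonotone if and only if $A^{-1}$ is paramonotone; consequently, the property $$(\forall x\in X)(\forall y\in X)\quad\|Sx-Sy\|^2=\langle x-y,Sx-Sy\rangle\;\Rightarrow\;\begin{cases}Sx=S(Sx+y-Sy)\\ Sy=S(Sy+x-Sx)\end{cases}$$ holds for $S=T$ if and only if it holds for $S=\mathrm{Id}-T$. Consequently, being paramonotone is a self-dual property for maximally monotone operators; correspondingly, satisfying the displayed property is a self-dual property for firmly nonexpansive mappings.
   Context: $X$ is a real Hilbert space; $\mathrm{Id}$ is the identity on $X$. $T\colon X\to X$ is firmly nonexpansive if $\|Tx-Ty\|^2+\|(\mathrm{Id}-T)x-(\mathrm{Id}-T)y\|^2\leq\|x-y\|^2$ for all $x,y\in X$. For $A\colon X\rightrightarrows X$ (so $Ax\subseteq X$ for each $x$): $\operatorname{gr}A=\{(x,u):u\in Ax\}$ and $x\in A^{-1}u\Leftrightarrow u\in Ax$. $A$ is monotone if $\langle x-y,u-v\rangle\geq0$ for all $(x,u),(y,v)\in\operatorname{gr}A$, and maximally monotone if it is monotone with no proper monotone extension. A monotone $A$ is paramonotone if for all $(x,u),(y,v)\in\operatorname{gr}A$, $\langle x-y,u-v\rangle=0$ implies $\{(x,v),(y,u)\}\subseteq\operatorname{gr}A$. The resolvent of a maximally monotone $A$ is $J_A=(\mathrm{Id}+A)^{-1}\colon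 X\to X$. A property of firmly nonexpansive mappings on $X$ is self-dual if, for every firmly nonexpansive $T\colon X\to X$, $T$ has it if and only if $\mathrm{Id}-T$ has it; a property of maximally monotone operators on $X$ is self-dual if, for every maximally monotone $A$, $A$ has it if and only if $A^{-1}$ has it. *)

theory Defs
  imports "HOL-Analysis.Analysis"
begin

text \<open>
  A real Hilbert space is a type of sort \<open>{real_inner, complete_space}\<close>; a set-valued operator
  on it is a function \<open>'a \<Rightarrow> 'a set\<close>. A single-valued map is regarded as a set-valued
  operator by \<open>single_valued_op\<close>, so that \<open>T = J\<^sub>A\<close> becomes
  \<open>single_valued_op T = resolvent A\<close>, an equality of set-valued operators.
\<close>

definition firmly_nonexpansive :: "('a::real_inner \<Rightarrow> 'a) \<Rightarrow> bool" where
  "firmly_nonexpansive T \<longleftrightarrow>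
     (\<forall>x y. (norm (T x - T y))\<^sup>2 + (norm ((x - T x) - (y - T y)))\<^sup>2 \<le> (norm (x - y))\<^sup>2)"

definition gr :: "('a \<Rightarrow> 'b set) \<Rightarrow> ('a \<times> 'b) set" where
  "gr A = {(x, u). u \<in> A x}"

definition inverse_op :: "('a \<Rightarrow> 'b set) \<Rightarrow> 'b \<Rightarrow> 'a set" where
  "inverse_op A u = {x. u \<in> A x}"

definition single_valued_op :: "('a \<Rightarrow> 'b) \<Rightarrow> 'a \<Rightarrow> 'b set" where
  "single_valued_op T x = {T x}"

definition plus_op :: "('a \<Rightarrow> 'b::plus set) \<Rightarrow> ('a \<Rightarrow> 'b set) \<Rightarrow> 'a \<Rightarrow> 'b set" where
  "plus_op A B x = {u + v | u v. u \<in> A x \<and> v \<in> B x}"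

definition minus_op :: "('a \<Rightarrow> 'b::minus set) \<Rightarrow> ('a \<Rightarrow> 'b set) \<Rightarrow> 'a \<Rightarrow> 'b set" where
  "minus_op A B x = {u - v | u v. u \<in> A x \<and> v \<in> B x}"

definition monotone_op :: "('a::real_inner \<Rightarrow> 'a set) \<Rightarrow> bool" where
  "monotone_op A \<longleftrightarrow> (\<forall>(x, u) \<in> gr A. \<forall>(y, v) \<in> gr A. 0 \<le> inner (x - y) (u - v))"

definition maximally_monotone :: "('a::real_inner \<Rightarrow> 'a set) \<Rightarrow> bool" where
  "maximally_monotone A \<longleftrightarrow> monotone_op A \<and> (\<nexists>B. monotone_op B \<and> gr A \<subset> gr B)"

definition paramonotone :: "('a::real_inner \<Rightarrow> 'a set) \<Rightarrow> bool" where
  "paramonotone A \<longleftrightarrow> monotone_op A \<and>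
     (\<forall>(x, u) \<in> gr A. \<forall>(y, v) \<in> gr A. inner (x - y) (u - v) = 0 \<longrightarrow> {(x, v), (y, u)} \<subseteq> gr A)"

definition resolvent :: "('a::real_inner \<Rightarrow> 'a set) \<Rightarrow> 'a \<Rightarrow> 'a set" where
  "resolvent A = inverse_op (plus_op (single_valued_op id) A)"

text \<open>The property of a firmly nonexpansive map that corresponds to paramonotonicity of the
  operator of which it is the resolvent.\<close>

definition swap_property :: "('a::real_inner \<Rightarrow> 'a) \<Rightarrow> bool" where
  "swap_property S \<longleftrightarrow>
     (\<forall>x y. (norm (S x - S y))\<^sup>2 = inner (x - y) (S x - S y) \<longrightarrow>
        S x = S (S x + y - S y) \<and> S y = S (S y + x - S x))"

definition self_dual_firmly_nonexpansive :: "(('a::real_inner \<Rightarrow> 'a) \<Rightarrow> bool) \<Rightarrow> bool" where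
  "self_dual_firmly_nonexpansive P \<longleftrightarrow>
     (\<forall>T. firmly_nonexpansive T \<longrightarrow> (P T \<longleftrightarrow> P (\<lambda>x. x - T x)))"

definition self_dual_maximally_monotone :: "(('a::real_inner \<Rightarrow> 'a set) \<Rightarrow> bool) \<Rightarrow> bool" where
  "self_dual_maximally_monotone P \<longleftrightarrow>
     (\<forall>A. maximally_monotone A \<longrightarrow> (P A \<longleftrightarrow> P (inverse_op A)))"

end

theory Submission
  imports Defs
begin

text \<open>
  Both properties are symmetric in the data: paramonotonicity is a condition on the graph that is
  unchanged by exchanging the two coordinates, and with \<open>S = Id - T\<close> in place of \<open>T\<close> the
  premise of the swap property is the same orthogonality relation between \<open>T x - T y\<close> and
  \<open>(x - T x) - (y - T y)\<close>, while the two equations of its conclusion change places.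
\<close>

lemma inverse_op_inverse_op [simp]: "inverse_op (inverse_op A) = A"
  by (simp add: inverse_op_def fun_eq_iff)

lemma mem_gr_inverse_op [simp]: "(u, x) \<in> gr (inverse_op A) \<longleftrightarrow> (x, u) \<in> gr A"
  by (simp add: gr_def inverse_op_def)

lemma paramonotone_iff:
  "paramonotone A \<longleftrightarrow> (\<forall>x u y v. (x, u) \<in> gr A \<longrightarrow> (y, v) \<in> gr A \<longrightarrow>
     0 \<le> inner (x - y) (u - v) \<and>
     (inner (x - y) (u - v) = 0 \<longrightarrow> (x, v) \<in> gr A \<and> (y, u) \<in> gr A))"
  unfolding paramonotone_def monotone_op_def by blast

lemma paramonotone_inverse_op:
  assumes "paramonotone A"
  shows "paramonotone (inverse_op A)"
  unfolding paramonotone_iff mem_gr_inverse_op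
proof (intro allI impI)
  fix u x v y
  assume "(x, u) \<in> gr A" "(y, v) \<in> gr A"
  with assms show "0 \<le> inner (u - v) (x - y) \<and>
      (inner (u - v) (x - y) = 0 \<longrightarrow> (y, u) \<in> gr A \<and> (x, v) \<in> gr A)"
    unfolding paramonotone_iff inner_commute[of "u - v" "x - y"] by blast
qed

text \<open>Inversion is an involution, so the converse is the one-sided implication applied to
  \<open>inverse_op A\<close>.\<close>

lemma paramonotone_inverse_op_iff: "paramonotone (inverse_op A) \<longleftrightarrow> paramonotone A"
  using paramonotone_inverse_op[of A] paramonotone_inverse_op[of "inverse_op A"] by auto

text \<open>Both equations describe the graph of \<open>A\<close> by the points
  \<open>(T x, x - T x)\<close>: the first is indexed by \<open>x\<close>, the second by the pair
  \<open>(z, u)\<close> with \<open>x = u + z\<close>.\<close>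

lemma single_valued_op_eq_resolvent_iff:
  fixes A :: "'a::real_inner \<Rightarrow> 'a set"
  shows "single_valued_op T = resolvent A \<longleftrightarrow>
    A = minus_op (inverse_op (single_valued_op T)) (single_valued_op id)"
proof -
  have mem_resolvent: "z \<in> resolvent A x \<longleftrightarrow> x - z \<in> A z" for x z
    by (force simp: resolvent_def inverse_op_def plus_op_def single_valued_op_def algebra_simps)
  have mem_minus: "u \<in> minus_op (inverse_op (single_valued_op T)) (single_valued_op id) z
      \<longleftrightarrow> z = T (u + z)" for u z
    by (force simp: minus_op_def inverse_op_def single_valued_op_def algebra_simps)
  have "single_valued_op T = resolvent A \<longleftrightarrow> (\<forall>x z. z = T x \<longleftrightarrow> x - z \<in> A z)"
    by (simp add: fun_eq_iff set_eq_iff mem_resolvent) (simp add: single_valued_op_def)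
  \<comment> \<open>For fixed \<open>z\<close>, the substitution \<open>x = u + z\<close> is a
    bijection between the values of \<open>u\<close> and \<open>x\<close>.\<close>
  also have "\<dots> \<longleftrightarrow> (\<forall>z u. u \<in> A z \<longleftrightarrow> z = T (u + z))" (is "?L \<longleftrightarrow> ?R")
  proof
    assume ?L
    then have "z = T (u + z) \<longleftrightarrow> u + z - z \<in> A z" for u z by blast
    then show ?R by simp
  next
    assume ?R
    then have "x - z \<in> A z \<longleftrightarrow> z = T (x - z + z)" for x z by blast
    then show ?L by simp
  qed
  also have "\<dots> \<longleftrightarrow> A = minus_op (inverse_op (single_valued_op T)) (single_valued_op id)"
    by (simp add: fun_eq_iff set_eq_iff mem_minus)
  finally show ?thesis .
qed

lemma swap_property_diff_iff:
  fixes T :: "'a::real_inner \<Rightarrow> 'a"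
  shows "swap_property (\<lambda>x. x - T x) \<longleftrightarrow> swap_property T"
proof -
  \<comment> \<open>Splitting \<open>x - y\<close> as
    \<open>(T x - T y) + ((x - T x) - (y - T y))\<close> cancels the squared norm on either side and
    leaves the same vanishing cross term.\<close>
  have premise: "(norm ((x - T x) - (y - T y)))\<^sup>2 = inner (x - y) ((x - T x) - (y - T y))
      \<longleftrightarrow> (norm (T x - T y))\<^sup>2 = inner (x - y) (T x - T y)" for x y
    by (auto simp: power2_norm_eq_inner inner_diff_left inner_diff_right inner_commute)
  \<comment> \<open>The first equation for \<open>Id - T\<close> is the second one for
    \<open>T\<close>; exchanging \<open>x\<close> and \<open>y\<close> matches the remaining
    two.\<close>
  have conclusion: "x - T x = (x - T x + y - (y - T y)) - T (x - T x + y - (y - T y))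
      \<longleftrightarrow> T y = T (T y + x - T x)" for x y
  proof -
    have "x - T x + y - (y - T y) = T y + x - T x" by simp
    moreover have "x - T x = T y + x - T x - w \<longleftrightarrow> T y = w" for w
      by (auto simp: algebra_simps)
    ultimately show ?thesis by metis
  qed
  show ?thesis
    unfolding swap_property_def premise conclusion by blast
qed

theorem theorem3p12:
  "(\<forall>(A :: 'a::{real_inner, complete_space} \<Rightarrow> 'a set) (T :: 'a \<Rightarrow> 'a).
      maximally_monotone A \<longrightarrow> firmly_nonexpansive T \<longrightarrow>
        (single_valued_op T = resolvent A \<longleftrightarrow>
           A = minus_op (inverse_op (single_valued_op T)) (single_valued_op id)) \<and>
        (single_valued_op T = resolvent A \<longrightarrow>
           (paramonotone A \<longleftrightarrow> paramonotone (inverse_op A)) \<and>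
           (swap_property T \<longleftrightarrow> swap_property (\<lambda>x. x - T x)))) \<and>
   self_dual_maximally_monotone (paramonotone :: ('a \<Rightarrow> 'a set) \<Rightarrow> bool) \<and>
   self_dual_firmly_nonexpansive (swap_property :: ('a \<Rightarrow> 'a) \<Rightarrow> bool)"
  \<comment> \<open>Rewriting with the two equivalences makes every duality claim trivial, so only
    the resolvent identity is left.\<close>
  unfolding self_dual_maximally_monotone_def self_dual_firmly_nonexpansive_def
    paramonotone_inverse_op_iff swap_property_diff_iff
  using single_valued_op_eq_resolvent_iff by blast

end
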